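(* There exists an absolute constant $c>0$ such that for all integers $k\ge 2$ and $\Delta$: if $1\le\Delta\le\frac k2$ then $n^*(k,\Delta)\ge c\,\frac{k-2\Delta}{\sqrt k}$; and if $1\le\Delta<\frac k4$ then $$n^*(k,\Delta)\ge c\,k\,\mathrm{arccosh}\Big(1+\frac{k}{4\Delta^2}\Big).$$ Moreover, $k\,\mathrm{arccosh}(1+\frac{k}{4\Delta^2})$ is within absolute constant factors of $k\log(1+\frac{k}{\Delta^2})$ when $\Delta\le\sqrt k$ and of $\frac{k^{3/2}}{\Delta}$ when $\Delta\ge\sqrt k$.
   Context: For an urn of $k$ colored balls let $C$ be its number of distinct colors. The sample complexity $n^*(k,\Delta)$ is the minimal integer $n$ such that there exists an integer-valued estimator $\hat C$ based on $n$ balls drawn independently and uniformly with replacement from the urn such that $\mathbb{P}[|\hat C-C|\ge\Delta]\le0.1$ for every urn containing $k$ balls. *)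

theory Defs
  imports "HOL-Probability.Probability"
begin

text \<open>An urn with k balls is a colouring u of the balls 0,...,k-1 (colours are natural
numbers; only the values of u on {0..<k} matter).  A sample of n balls drawn independently
and uniformly with replacement is a uniformly random list of n ball indices in {0..<k};
the estimator only sees the sequence of observed colours.\<close>

definition num_colors :: "nat \<Rightarrow> (nat \<Rightarrow> nat) \<Rightarrow> nat" where
  "num_colors k u = card (u ` {0..<k})"

definition index_samples :: "nat \<Rightarrow> nat \<Rightarrow> nat list set" where
  "index_samples k n = {xs. length xs = n \<and> set xs \<subseteq> {0..<k}}"

definition err_prob :: "nat \<Rightarrow> nat \<Rightarrow> (nat list \<Rightarrow> int) \<Rightarrow> (nat \<Rightarrow> nat) \<Rightarrow> int \<Rightarrow> real" where
  "err_prob k n est u Delta =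
     measure_pmf.prob (pmf_of_set (index_samples k n))
       {xs. \<bar>est (map u xs) - int (num_colors k u)\<bar> \<ge> Delta}"

definition sample_complexity :: "nat \<Rightarrow> int \<Rightarrow> nat" where
  "sample_complexity k Delta =
     (LEAST n. \<exists>est :: nat list \<Rightarrow> int. \<forall>u :: nat \<Rightarrow> nat. err_prob k n est u Delta \<le> 1/10)"

end

theory Submission
  imports Defs
begin

text \<open>
Both lower bounds come from a second moment argument that compares the urn in which all balls have
different colours, so that the sample is uniform on ball sequences, with a uniform mixture of urns
\<open>u \<theta>\<close> having at most \<open>k - (2 \<Delta> - 1)\<close> colours.  A good estimator yields an event of
probability at most 1/10 under the former and at least 9/10 under the latter, so by Cauchy-Schwarz
the likelihood ratio has second moment at least 8.1.  That second moment is the average over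
independent \<open>\<theta>, \<theta>'\<close> of \<open>(N / k) ^ n\<close>, where \<open>N\<close> counts the pairs of balls \<open>(x, y)\<close> with
\<open>u \<theta> x = u \<theta>' y\<close>.  The balls are cut into equal blocks that are recoloured independently;
then \<open>N\<close> is a sum over blocks, and \<open>1 + t \<le> exp t\<close> makes the average factorise.

For the first bound every block is merged into the colour of one random ball of the block, which gives
\<open>n b \<ge> sqrt k\<close> for blocks of size \<open>b\<close>, about \<open>k / (k - 2 \<Delta>)\<close>.  For the second bound a block of
size \<open>2 M\<close> consists of \<open>M\<close> pairs and one random ball takes the colour of its partner.  Two such
recolourings of a block have excess overlap 2 or -2, each with probability \<open>1 / (2 M)\<close>, and 0
otherwise, so the second moment is at most \<open>exp (D / M * (cosh (2 n / k) - 1))\<close> for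
\<open>D = 2 \<Delta> - 1\<close> blocks with \<open>M\<close> about \<open>k / (2 D)\<close>.
\<close>

section \<open>Samples as lists of ball indices, and the second moment inequality\<close>

text \<open>Zipping turns a matching pair of lists into a list of \<open>n\<close> freely chosen
  matching pairs; this is the source of the \<open>n\<close>-th power in the second moment.\<close>

lemma card_pairs_of_matching_lists:
  assumes "finite A" "finite B"
  shows "card {(xs, ys). length xs = n \<and> set xs \<subseteq> A \<and> length ys = n \<and> set ys \<subseteq> B \<and> map f xs = map g ys}
    = card {(x, y). x \<in> A \<and> y \<in> B \<and> f x = g y} ^ n"
proof -
  let ?P = "{(x, y). x \<in> A \<and> y \<in> B \<and> f x = g y}"
  let ?S = "{(xs, ys). length xs = n \<and> set xs \<subseteq> A \<and> length ys = n \<and> set ys \<subseteq> B \<and> map f xs = map g ys}"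
  have fin: "finite ?P"
    by (rule finite_subset[of _ "A \<times> B"]) (use assms in auto)
  have "bij_betw (\<lambda>ps. (map fst ps, map snd ps)) {ps. set ps \<subseteq> ?P \<and> length ps = n} ?S"
    unfolding bij_betw_def
  proof
    show "inj_on (\<lambda>ps. (map fst ps, map snd ps)) {ps. set ps \<subseteq> ?P \<and> length ps = n}"
      by (rule inj_onI) (metis Pair_inject zip_map_fst_snd)
    have "(xs, ys) \<in> (\<lambda>ps. (map fst ps, map snd ps)) ` {ps. set ps \<subseteq> ?P \<and> length ps = n}"
      if "(xs, ys) \<in> ?S" for xs ys
    proof (rule image_eqI[where x = "zip xs ys"])
      show "(xs, ys) = (map fst (zip xs ys), map snd (zip xs ys))"
        using that by simp
      have "f x = g y" if "(x, y) \<in> set (zip xs ys)" for x y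
        using that \<open>(xs, ys) \<in> ?S\<close> by (auto simp: in_set_zip) (metis nth_map)
      then show "zip xs ys \<in> {ps. set ps \<subseteq> ?P \<and> length ps = n}"
        using that by (auto dest: set_zip_leftD set_zip_rightD)
    qed
    then show "(\<lambda>ps. (map fst ps, map snd ps)) ` {ps. set ps \<subseteq> ?P \<and> length ps = n} = ?S"
      by fastforce
  qed
  then show ?thesis
    using card_lists_length_eq[OF fin, of n] by (simp add: bij_betw_same_card)
qed

lemma finite_index_samples: "finite (index_samples k n)"
  and card_index_samples: "card (index_samples k n) = k ^ n"
  using finite_lists_length_eq[of "{0..<k}" n] card_lists_length_eq[of "{0..<k}" n]
  by (simp_all add: index_samples_def conj_commute)

lemma index_samples_nonempty: "k > 0 \<Longrightarrow> index_samples k n \<noteq> {}"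
  using card_index_samples[of k n] by force

lemma err_prob_eq:
  assumes "k > 0"
  shows "err_prob k n est u Delta
    = card {xs \<in> index_samples k n. \<bar>est (map u xs) - int (num_colors k u)\<bar> \<ge> Delta} / real k ^ n"
  using assms finite_index_samples[of k n] index_samples_nonempty[of k n]
  by (simp add: err_prob_def measure_pmf_of_set card_index_samples Int_def)

text \<open>Under the urn \<open>u \<theta>\<close> the sequence \<open>ys\<close> has probability
  \<open>w \<theta> ys / k ^ n\<close>, against \<open>1 / k ^ n\<close> under the uniform law, so
  \<open>w \<theta>\<close> is a likelihood ratio. Cauchy-Schwarz on the test event \<open>G\<close>
  yields (9/10)^2 / (1/10) = 81/10.\<close>

lemma second_moment_bound:
  fixes u :: "'a \<Rightarrow> nat \<Rightarrow> nat"
  assumes k: "k > 0"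
    and range: "\<And>\<theta>. \<theta> \<in> T \<Longrightarrow> u \<theta> ` {..<k} \<subseteq> {..<k}"
    and small: "card {ys \<in> index_samples k n. ys \<in> G} \<le> real k ^ n / 10"
    and large: "\<And>\<theta>. \<theta> \<in> T \<Longrightarrow> card {xs \<in> index_samples k n. map (u \<theta>) xs \<in> G} \<ge> 9 / 10 * real k ^ n"
  shows "81 / 10 * (real (card T))\<^sup>2 * real k ^ n
    \<le> (\<Sum>\<theta>\<in>T. \<Sum>\<theta>'\<in>T. real (card {(x, y). x < k \<and> y < k \<and> u \<theta> x = u \<theta>' y}) ^ n)"
proof -
  define L where "L = index_samples k n"
  define w where "w \<theta> ys = real (card {xs \<in> L. map (u \<theta>) xs = ys})" for \<theta> ys
  have finL: "finite L" by (simp add: L_def finite_index_samples)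
  have mapL: "map (u \<theta>) xs \<in> L" if "\<theta> \<in> T" "xs \<in> L" for \<theta> xs
    using range[OF that(1)] that(2) by (force simp: L_def index_samples_def)
  have w_sum: "(\<Sum>ys\<in>L \<inter> G. w \<theta> ys) = card {xs \<in> L. map (u \<theta>) xs \<in> G}" if "\<theta> \<in> T" for \<theta>
  proof -
    have "{xs \<in> L. map (u \<theta>) xs \<in> G} = (\<Union>ys\<in>L \<inter> G. {xs \<in> L. map (u \<theta>) xs = ys})"
      using mapL[OF that] by auto
    then have "card {xs \<in> L. map (u \<theta>) xs \<in> G} = (\<Sum>ys\<in>L \<inter> G. card {xs \<in> L. map (u \<theta>) xs = ys})"
      using finL by (simp only:) (rule card_UN_disjoint, auto)
    then show ?thesis by (simp add: w_def)
  qed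
  have w_prod: "(\<Sum>ys\<in>L. w \<theta> ys * w \<theta>' ys)
      = real (card {(x, y). x < k \<and> y < k \<and> u \<theta> x = u \<theta>' y}) ^ n" if "\<theta> \<in> T" "\<theta>' \<in> T" for \<theta> \<theta>'
  proof -
    \<comment> \<open>A product of fibre sizes, summed over \<open>ys\<close>, counts the pairs of
      samples that show the same sequence.\<close>
    let ?S = "\<lambda>ys. {xs \<in> L. map (u \<theta>) xs = ys} \<times> {xs \<in> L. map (u \<theta>') xs = ys}"
    have "(\<Sum>ys\<in>L. w \<theta> ys * w \<theta>' ys) = real (\<Sum>ys\<in>L. card (?S ys))"
      by (simp add: w_def card_cartesian_product)
    also have "(\<Sum>ys\<in>L. card (?S ys)) = card (\<Union>ys\<in>L. ?S ys)"
      by (rule card_UN_disjoint[symmetric]) (use finL in auto)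
    also have "(\<Union>ys\<in>L. ?S ys) = {(xs, ys). xs \<in> L \<and> ys \<in> L \<and> map (u \<theta>) xs = map (u \<theta>') ys}"
      by (auto intro: mapL[OF that(1)])
    also have "\<dots> = {(xs, ys). length xs = n \<and> set xs \<subseteq> {..<k} \<and> length ys = n
        \<and> set ys \<subseteq> {..<k} \<and> map (u \<theta>) xs = map (u \<theta>') ys}"
      by (simp add: L_def index_samples_def atLeast0LessThan)
    also have "card \<dots> = card {(x, y). x < k \<and> y < k \<and> u \<theta> x = u \<theta>' y} ^ n"
      by (subst card_pairs_of_matching_lists) auto
    finally show ?thesis by simp
  qed
  have "9 / 10 * real k ^ n * card T \<le> (\<Sum>\<theta>\<in>T. \<Sum>ys\<in>L \<inter> G. w \<theta> ys)"
    using sum_mono[OF large] w_sum by (simp add: L_def algebra_simps)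
  also have "\<dots> = (\<Sum>ys\<in>L \<inter> G. \<Sum>\<theta>\<in>T. w \<theta> ys)"
    by (rule sum.swap)
  finally have "(9 / 10 * real k ^ n * card T)\<^sup>2 \<le> (\<Sum>ys\<in>L \<inter> G. \<Sum>\<theta>\<in>T. w \<theta> ys)\<^sup>2"
    by (rule power_mono) simp
  also have "\<dots> \<le> (\<Sum>ys\<in>L \<inter> G. (\<Sum>\<theta>\<in>T. w \<theta> ys)\<^sup>2) * card (L \<inter> G)"
    by (rule sum_squared_le_sum_of_squares)
  also have "\<dots> \<le> (\<Sum>ys\<in>L. (\<Sum>\<theta>\<in>T. w \<theta> ys)\<^sup>2) * (real k ^ n / 10)"
    using small finL by (intro mult_mono sum_mono2) (auto simp: L_def Int_def intro: sum_nonneg)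
  also have "(\<Sum>ys\<in>L. (\<Sum>\<theta>\<in>T. w \<theta> ys)\<^sup>2) = (\<Sum>ys\<in>L. \<Sum>\<theta>\<in>T. \<Sum>\<theta>'\<in>T. w \<theta> ys * w \<theta>' ys)"
    by (simp add: power2_eq_square sum_product)
  also have "\<dots> = (\<Sum>\<theta>\<in>T. \<Sum>\<theta>'\<in>T. \<Sum>ys\<in>L. w \<theta> ys * w \<theta>' ys)"
    by (subst sum.swap, rule sum.cong[OF refl], rule sum.swap)
  also have "\<dots> = (\<Sum>\<theta>\<in>T. \<Sum>\<theta>'\<in>T. real (card {(x, y). x < k \<and> y < k \<and> u \<theta> x = u \<theta>' y}) ^ n)"
    by (intro sum.cong refl w_prod)
  finally have "81 / 100 * (real k ^ n) * (real k ^ n * (card T)\<^sup>2)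
    \<le> (\<Sum>\<theta>\<in>T. \<Sum>\<theta>'\<in>T. real (card {(x, y). x < k \<and> y < k \<and> u \<theta> x = u \<theta>' y}) ^ n) / 10 * real k ^ n"
    by (simp add: power2_eq_square algebra_simps)
  then show ?thesis
    using k by (simp add: field_simps)
qed

text \<open>For the urn with \<open>k\<close> colours, \<open>est ys \<le> k - Delta\<close> is an
  error of at least \<open>Delta\<close>. For an urn with at most \<open>k - 2 * Delta + 1\<close>
  colours the opposite is such an error, since by integrality it means
  \<open>est ys \<ge> k - Delta + 1\<close>.\<close>

lemma second_moment_bound_estimator:
  fixes u :: "'a \<Rightarrow> nat \<Rightarrow> nat"
  assumes k: "k > 0"
    and range: "\<And>\<theta>. \<theta> \<in> T \<Longrightarrow> u \<theta> ` {..<k} \<subseteq> {..<k}"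
    and cols: "\<And>\<theta>. \<theta> \<in> T \<Longrightarrow> int (num_colors k (u \<theta>)) \<le> int k - 2 * Delta + 1"
    and est: "\<And>v. err_prob k n est v Delta \<le> 1 / 10"
  shows "81 / 10 * (real (card T))\<^sup>2 * real k ^ n
    \<le> (\<Sum>\<theta>\<in>T. \<Sum>\<theta>'\<in>T. real (card {(x, y). x < k \<and> y < k \<and> u \<theta> x = u \<theta>' y}) ^ n)"
proof (rule second_moment_bound[OF k range, where G = "{ys. est ys \<le> int k - Delta}"])
  let ?L = "index_samples k n"
  have kn: "real k ^ n > 0" using k by simp
  have err: "card {xs \<in> ?L. \<bar>est (map v xs) - int (num_colors k v)\<bar> \<ge> Delta} \<le> real k ^ n / 10" for v
    using est[of v] kn by (simp add: err_prob_eq[OF k] field_simps)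
  have "num_colors k (\<lambda>x. x) = k" by (simp add: num_colors_def)
  then have "real (card {ys \<in> ?L. ys \<in> {ys. est ys \<le> int k - Delta}})
      \<le> card {xs \<in> ?L. \<bar>est (map (\<lambda>x. x) xs) - int (num_colors k (\<lambda>x. x))\<bar> \<ge> Delta}"
    by (intro of_nat_mono card_mono) (auto simp: finite_index_samples)
  then show "real (card {ys \<in> ?L. ys \<in> {ys. est ys \<le> int k - Delta}}) \<le> real k ^ n / 10"
    using err[of "\<lambda>x. x"] by linarith
  show "9 / 10 * real k ^ n \<le> card {xs \<in> ?L. map (u \<theta>) xs \<in> {ys. est ys \<le> int k - Delta}}"
    if "\<theta> \<in> T" for \<theta>
  proof -
    let ?E = "{xs \<in> ?L. \<bar>est (map (u \<theta>) xs) - int (num_colors k (u \<theta>))\<bar> \<ge> Delta}"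
    have "real k ^ n - card ?E = card ?L - card ?E"
      by (simp add: card_index_samples card_mono finite_index_samples flip: card_index_samples)
    also have "\<dots> = card (?L - ?E)"
      by (simp add: card_Diff_subset finite_index_samples)
    also have "\<dots> \<le> card {xs \<in> ?L. map (u \<theta>) xs \<in> {ys. est ys \<le> int k - Delta}}"
      using cols[OF that] by (intro of_nat_mono card_mono) (auto simp: finite_index_samples)
    finally show ?thesis using err[of "u \<theta>"] by simp
  qed
qed auto

section \<open>Independent recolourings of equal blocks\<close>

text \<open>
The first \<open>D * b\<close> balls form \<open>D\<close> blocks of size \<open>b\<close>, and \<open>g j\<close> is the \<open>j\<close>-th way to recolour a
block; the remaining balls keep their own colours.
\<close>

definition block_coloring :: "nat \<Rightarrow> nat \<Rightarrow> (nat \<Rightarrow> nat \<Rightarrow> nat) \<Rightarrow> (nat \<Rightarrow> nat) \<Rightarrow> nat \<Rightarrow> nat" where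
  "block_coloring b D g \<theta> x =
     (if x < D * b then x div b * b + g (\<theta> (x div b)) (x mod b) else x)"

lemma block_index_less:
  fixes i b t D :: nat
  assumes "t < D" "i < b"
  shows "t * b + i < D * b"
proof -
  have "t * b + i < Suc t * b" using assms by simp
  also have "\<dots> \<le> D * b" using assms by (intro mult_right_mono) auto
  finally show ?thesis .
qed

lemma block_index_exhaust:
  fixes x b D :: nat
  assumes "x < D * b"
  obtains t i where "t < D" "i < b" "x = t * b + i"
proof
  show "x div b < D" using assms by (simp add: less_mult_imp_div_less)
  show "x mod b < b" using assms by (intro mod_less_divisor) (cases b, auto)
  show "x = x div b * b + x mod b" by simp
qed

lemma block_index_inject:
  fixes i i' b t t' :: nat
  assumes "i < b" "i' < b"
  shows "t * b + i = t' * b + i' \<longleftrightarrow> t = t' \<and> i = i'"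
proof
  assume eq: "t * b + i = t' * b + i'"
  have "t = (t * b + i) div b" "t' = (t' * b + i') div b" using assms by auto
  then show "t = t' \<and> i = i'" using eq by auto
qed simp

lemma block_coloring_index:
  "t < D \<Longrightarrow> i < b \<Longrightarrow> block_coloring b D g \<theta> (t * b + i) = t * b + g (\<theta> t) i"
  using block_index_less[of t D i b] by (simp add: block_coloring_def)

lemma block_coloring_outside: "D * b \<le> x \<Longrightarrow> block_coloring b D g \<theta> x = x"
  by (simp add: block_coloring_def)

lemma block_coloring_less:
  assumes g: "\<And>j i. j < b \<Longrightarrow> i < b \<Longrightarrow> g j i < b"
    and \<theta>: "\<theta> \<in> {..<D} \<rightarrow>\<^sub>E {..<b}" and x: "x < D * b"
  shows "block_coloring b D g \<theta> x < D * b"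
proof -
  obtain t i where t: "t < D" "i < b" "x = t * b + i" using x by (rule block_index_exhaust)
  then show ?thesis
    using \<theta> g[of "\<theta> t" i] by (auto simp: block_coloring_index intro!: block_index_less)
qed

lemma num_colors_block_coloring_le:
  assumes q: "\<And>j. j < b \<Longrightarrow> card (g j ` {..<b}) \<le> q"
    and \<theta>: "\<theta> \<in> {..<D} \<rightarrow>\<^sub>E {..<b}" and k: "D * b \<le> k"
  shows "num_colors k (block_coloring b D g \<theta>) \<le> (k - D * b) + D * q"
proof -
  let ?u = "block_coloring b D g \<theta>"
  let ?S = "\<lambda>t. (\<lambda>c. t * b + c) ` (g (\<theta> t) ` {..<b})"
  have "?u ` {0..<k} \<subseteq> {D * b..<k} \<union> (\<Union>t<D. ?S t)"
  proof (intro image_subsetI)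
    fix x assume x: "x \<in> {0..<k}"
    show "?u x \<in> {D * b..<k} \<union> (\<Union>t<D. ?S t)"
    proof (cases "x < D * b")
      case True
      then obtain t i where "t < D" "i < b" "x = t * b + i" by (rule block_index_exhaust)
      then show ?thesis by (auto simp: block_coloring_index)
    qed (use x in \<open>simp add: block_coloring_outside\<close>)
  qed
  then have "num_colors k ?u \<le> card ({D * b..<k} \<union> (\<Union>t<D. ?S t))"
    unfolding num_colors_def by (intro card_mono) auto
  also have "\<dots> \<le> card {D * b..<k} + card (\<Union>t<D. ?S t)" by (rule card_Un_le)
  also have "card (\<Union>t<D. ?S t) \<le> (\<Sum>t<D. card (?S t))" by (rule card_UN_le) simp
  also have "\<dots> \<le> (\<Sum>t<D. q)"
  proof (rule sum_mono)
    fix t assume "t \<in> {..<D}"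
    then have "\<theta> t < b" using \<theta> by auto
    then show "card (?S t) \<le> q" using q by (meson card_image_le finite_imageI finite_lessThan le_trans)
  qed
  finally show ?thesis by simp
qed

text \<open>Recolouring keeps each ball within the colours of its own block, and balls outside the
  blocks keep theirs. So a match joins two balls of one block, or an outside ball with
  itself.\<close>

lemma card_block_coloring_matches:
  assumes g: "\<And>j i. j < b \<Longrightarrow> i < b \<Longrightarrow> g j i < b"
    and \<theta>: "\<theta> \<in> {..<D} \<rightarrow>\<^sub>E {..<b}" and \<theta>': "\<theta>' \<in> {..<D} \<rightarrow>\<^sub>E {..<b}" and k: "D * b \<le> k"
  shows "card {(x, y). x < k \<and> y < k \<and> block_coloring b D g \<theta> x = block_coloring b D g \<theta>' y}
    = (k - D * b) + (\<Sum>t<D. card {(i, i'). i < b \<and> i' < b \<and> g (\<theta> t) i = g (\<theta>' t) i'})"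
proof -
  let ?u = "block_coloring b D g \<theta>" and ?v = "block_coloring b D g \<theta>'"
  let ?R = "\<lambda>t. {(i, i'). i < b \<and> i' < b \<and> g (\<theta> t) i = g (\<theta>' t) i'}"
  let ?I = "(\<lambda>(t, i, i'). (t * b + i, t * b + i')) ` (SIGMA t:{..<D}. ?R t)"
  let ?Q = "(\<lambda>x. (x, x)) ` {D * b..<k}"
  have finR: "finite (?R t)" for t
    by (rule finite_subset[of _ "{..<b} \<times> {..<b}"]) auto
  have less: "?u x < D * b \<longleftrightarrow> x < D * b" "?v x < D * b \<longleftrightarrow> x < D * b" for x
    using block_coloring_less[where g = g, OF g \<theta>] block_coloring_less[where g = g, OF g \<theta>']
      block_coloring_outside[of D b x g] by (metis linorder_not_less)+
  have I_less: "x < D * b \<and> y < D * b \<and> ?u x = ?v y" if "(x, y) \<in> ?I" for x y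
    using that by (auto simp: block_coloring_index block_index_less)
  have "(x, y) \<in> ?Q \<union> ?I" if "x < k" "y < k" "?u x = ?v y" for x y
  proof (cases "x < D * b")
    case True
    then have "y < D * b" using less that by metis
    then obtain t' i' where y: "t' < D" "i' < b" "y = t' * b + i'" by (rule block_index_exhaust)
    from True obtain t i where x: "t < D" "i < b" "x = t * b + i" by (rule block_index_exhaust)
    have lt: "g (\<theta> t) i < b" "g (\<theta>' t') i' < b" using \<theta> \<theta>' x y by (auto intro!: g)
    have "t * b + g (\<theta> t) i = t' * b + g (\<theta>' t') i'"
      using that(3) x y by (simp add: block_coloring_index)
    then have "t = t'" "g (\<theta> t) i = g (\<theta>' t) i'"
      using block_index_inject[OF lt] by auto
    then show ?thesis using x y by (intro UnI2 image_eqI[of _ _ "(t, i, i')"]) auto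
  next
    case False
    then have "\<not> y < D * b" using less that by metis
    then show ?thesis using False that by (auto simp: block_coloring_outside)
  qed
  moreover have "x < k \<and> y < k \<and> ?u x = ?v y" if "(x, y) \<in> ?Q \<union> ?I" for x y
    using that
  proof
    assume "(x, y) \<in> ?I"
    from I_less[OF this] show ?thesis using k by linarith
  qed (auto simp: block_coloring_outside)
  ultimately have "{(x, y). x < k \<and> y < k \<and> ?u x = ?v y} = ?Q \<union> ?I"
    by (intro equalityI subrelI) blast+
  moreover have "?Q \<inter> ?I = {}"
  proof (intro equals0I, elim IntE)
    fix p assume "p \<in> ?Q" "p \<in> ?I"
    from \<open>p \<in> ?Q\<close> obtain x where x: "p = (x, x)" "D * b \<le> x" by auto
    from I_less[OF \<open>p \<in> ?I\<close>[unfolded x]] x show False by linarith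
  qed
  moreover have "inj_on (\<lambda>(t, i, i'). (t * b + i, t * b + i')) (SIGMA t:{..<D}. ?R t)"
    by (rule inj_onI) (auto simp: block_index_inject)
  then have "card ?I = (\<Sum>t<D. card (?R t))"
    using finR by (simp add: card_image card_SigmaI)
  moreover have "card ?Q = k - D * b" by (simp add: card_image inj_on_def)
  moreover have "finite ?I" "finite ?Q" using finR by auto
  ultimately show ?thesis by (simp add: card_Un_disjoint)
qed

lemma block_second_moment_bound:
  assumes k: "k > 0" "D * b \<le> k" and b: "b > 0"
    and g: "\<And>j i. j < b \<Longrightarrow> i < b \<Longrightarrow> g j i < b"
    and q: "\<And>j. j < b \<Longrightarrow> card (g j ` {..<b}) \<le> q"
    and cols: "int k - int (D * b) + int (D * q) \<le> int k - 2 * Delta + 1"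
    and est: "\<And>v. err_prob k n est v Delta \<le> 1 / 10"
  shows "81 / 10 \<le> ((\<Sum>j<b. \<Sum>j'<b. exp (real n / real k *
      (real (card {(i, i'). i < b \<and> i' < b \<and> g j i = g j' i'}) - real b))) / (real b)\<^sup>2) ^ D"
proof -
  define T where "T = {..<D} \<rightarrow>\<^sub>E {..<b}"
  define R where "R j j' = real (card {(i, i'). i < b \<and> i' < b \<and> g j i = g j' i'})" for j j'
  define F where "F j j' = exp (real n / real k * (R j j' - real b))" for j j'
  let ?N = "\<lambda>\<theta> \<theta>'. real (card {(x, y). x < k \<and> y < k \<and>
    block_coloring b D g \<theta> x = block_coloring b D g \<theta>' y})"
  have cardT: "card T = b ^ D" by (simp add: T_def card_PiE)
  have "81 / 10 * (real (card T))\<^sup>2 * real k ^ n \<le> (\<Sum>\<theta>\<in>T. \<Sum>\<theta>'\<in>T. ?N \<theta> \<theta>' ^ n)"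
  proof (rule second_moment_bound_estimator[OF k(1)])
    fix \<theta> assume \<theta>: "\<theta> \<in> T"
    show "block_coloring b D g \<theta> ` {..<k} \<subseteq> {..<k}"
    proof (intro image_subsetI)
      fix x assume "x \<in> {..<k}"
      then show "block_coloring b D g \<theta> x \<in> {..<k}"
        using block_coloring_less[where g = g and x = x and \<theta> = \<theta>, OF g, of D] \<theta> k
        by (cases "x < D * b") (auto simp: T_def block_coloring_outside)
    qed
    have "num_colors k (block_coloring b D g \<theta>) \<le> (k - D * b) + D * q"
      using num_colors_block_coloring_le[where g = g, OF q] \<theta> k by (simp add: T_def)
    then show "int (num_colors k (block_coloring b D g \<theta>)) \<le> int k - 2 * Delta + 1"
      using cols k by linarith
  qed (use est in simp)
  also have "\<dots> \<le> (\<Sum>\<theta>\<in>T. \<Sum>\<theta>'\<in>T. real k ^ n * (\<Prod>t<D. F (\<theta> t) (\<theta>' t)))"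
  proof (intro sum_mono)
    fix \<theta> \<theta>' assume "\<theta> \<in> T" "\<theta>' \<in> T"
    then have "?N \<theta> \<theta>' = real k - real D * real b + (\<Sum>t<D. R (\<theta> t) (\<theta>' t))"
      using card_block_coloring_matches[where g = g and \<theta> = \<theta> and \<theta>' = \<theta>', OF g _ _ k(2)] k(2)
      by (simp add: T_def R_def of_nat_diff)
    \<comment> \<open>The outside balls cancel: the overlap exceeds \<open>k\<close> by the sum of
      the excesses \<open>R - b\<close> of the blocks.\<close>
    also have "\<dots> = real k * (1 + (\<Sum>t<D. R (\<theta> t) (\<theta>' t) - real b) / real k)"
      using k by (simp add: sum_subtractf field_simps)
    also have "\<dots> \<le> real k * exp ((\<Sum>t<D. R (\<theta> t) (\<theta>' t) - real b) / real k)"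
      by (intro mult_left_mono) auto
    finally have "?N \<theta> \<theta>' ^ n \<le> (real k * exp ((\<Sum>t<D. R (\<theta> t) (\<theta>' t) - real b) / real k)) ^ n"
      by (rule power_mono) simp
    also have "\<dots> = real k ^ n * (\<Prod>t<D. F (\<theta> t) (\<theta>' t))"
      by (simp add: F_def power_mult_distrib exp_sum sum_distrib_left flip: exp_of_nat_mult)
        (simp add: sum_distrib_left sum_divide_distrib flip: exp_sum)
    finally show "?N \<theta> \<theta>' ^ n \<le> real k ^ n * (\<Prod>t<D. F (\<theta> t) (\<theta>' t))" .
  qed
  also have "\<dots> = real k ^ n * (\<Sum>\<theta>\<in>T. \<Sum>\<theta>'\<in>T. \<Prod>t<D. F (\<theta> t) (\<theta>' t))"
    by (simp add: sum_distrib_left)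
  \<comment> \<open>A sum of products over all choice functions is a product of sums, first for
    \<open>\<theta>'\<close> with \<open>\<theta>\<close> fixed, then for
    \<open>\<theta>\<close>.\<close>
  also have "(\<Sum>\<theta>\<in>T. \<Sum>\<theta>'\<in>T. \<Prod>t<D. F (\<theta> t) (\<theta>' t)) = (\<Sum>\<theta>\<in>T. \<Prod>t<D. \<Sum>j'<b. F (\<theta> t) j')"
    unfolding T_def by (intro sum.cong refl prod_sum_PiE[symmetric]) auto
  also have "\<dots> = (\<Prod>t<D. \<Sum>j<b. \<Sum>j'<b. F j j')"
    unfolding T_def by (rule prod_sum_PiE[symmetric]) auto
  also have "\<dots> = (\<Sum>j<b. \<Sum>j'<b. F j j') ^ D" by simp
  finally have "81 / 10 * (real b ^ D)\<^sup>2 \<le> (\<Sum>j<b. \<Sum>j'<b. F j j') ^ D"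
    using k by (simp add: cardT)
  then show ?thesis
    using b by (simp add: F_def R_def power_divide field_simps flip: power_mult)
qed

section \<open>Blocks merged into a single colour\<close>

text \<open>Two merged blocks overlap in \<open>b^2\<close> pairs if they chose the same ball, which
  has probability \<open>1 / b\<close>, and in none otherwise. With \<open>a = n b / k\<close> the
  mean factor per block is at most \<open>exp (a^2 b)\<close> while \<open>a b \<le> 1\<close>, so
  the second moment is at most \<open>exp (a^2 k) = exp ((n b)^2 / k)\<close>.\<close>

lemma merged_blocks_bound:
  assumes k: "k > 0" and b: "b > 0"
    and cols: "int (k div b) + int (k mod b) \<le> int k - 2 * Delta + 1"
    and est: "\<And>v. err_prob k n est v Delta \<le> 1 / 10"
  shows "sqrt (real k) \<le> real n * real b"
proof -
  define D where "D = k div b"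
  define a where "a = real n * real b / real k"
  define r where "r = real n / real k"
  have Db: "D * b + k mod b = k" by (simp add: D_def)
  have "D * b \<le> k" using Db by linarith
  have overlap: "real (card {(i::nat, i'::nat). i < b \<and> i' < b \<and> j = j'}) = of_bool (j = j') * (real b)\<^sup>2"
    for j j' :: nat
  proof -
    have "{(i::nat, i'::nat). i < b \<and> i' < b \<and> j = j'} = (if j = j' then {..<b} \<times> {..<b} else {})" by auto
    then show ?thesis by (simp add: power2_eq_square)
  qed
  have row: "(\<Sum>j'<b. exp (r * (of_bool (j = j') * (real b)\<^sup>2 - real b)))
      = exp (- a) * (exp (a * real b) + real b - 1)" if "j < b" for j
  proof -
    have "exp (r * (of_bool (j = j') * (real b)\<^sup>2 - real b))
        = exp (- a) * (1 + of_bool (j = j') * (exp (a * real b) - 1))" for j'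
      by (simp add: a_def r_def power2_eq_square algebra_simps flip: exp_add)
    then have "(\<Sum>j'<b. exp (r * (of_bool (j = j') * (real b)\<^sup>2 - real b)))
        = exp (- a) * (\<Sum>j'<b. 1 + of_bool (j = j') * (exp (a * real b) - 1))"
      by (simp only: sum_distrib_left)
    also have "(\<Sum>j'<b. 1 + of_bool (j = j') * (exp (a * real b) - 1)) = exp (a * real b) + real b - 1"
      using that by (simp add: sum.distrib of_bool_def if_distrib[of "\<lambda>x. x * _"] cong: if_cong)
    finally show ?thesis .
  qed
  have "81 / 10 \<le> ((\<Sum>j<b. \<Sum>j'<b. exp (r *
      (real (card {(i::nat, i'::nat). i < b \<and> i' < b \<and> j = j'}) - real b))) / (real b)\<^sup>2) ^ D"
    unfolding r_def
  proof (rule block_second_moment_bound[OF k \<open>D * b \<le> k\<close> b, where g = "\<lambda>j i. j" and q = 1])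
    show "int k - int (D * b) + int (D * 1) \<le> int k - 2 * Delta + 1"
      using cols arg_cong[OF Db, of int] by (simp add: D_def[symmetric])
    show "card ((\<lambda>i. j) ` {..<b}) \<le> 1" for j :: nat by (cases "b = 0") (auto simp: image_constant_conv)
  qed (use est in auto)
  also have "(\<Sum>j<b. \<Sum>j'<b. exp (r *
      (real (card {(i::nat, i'::nat). i < b \<and> i' < b \<and> j = j'}) - real b))) / (real b)\<^sup>2
      = exp (- a) * ((exp (a * real b) - 1) / real b + 1)" (is "?S / _ = _")
  proof -
    have "?S = (\<Sum>j<b. exp (- a) * (exp (a * real b) + real b - 1))"
      by (rule sum.cong[OF refl]) (unfold overlap, rule row, simp)
    then show ?thesis using b by (simp add: power2_eq_square field_simps)
  qed
  finally have main: "81 / 10 \<le> (exp (- a) * ((exp (a * real b) - 1) / real b + 1)) ^ D" .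
  have a0: "a \<ge> 0" by (simp add: a_def)
  show ?thesis
  proof (cases "a * real b \<le> 1")
    case True
    \<comment> \<open>After division by \<open>b\<close>, the linear term cancels against
      \<open>exp (- a)\<close> and only \<open>a^2 b\<close> remains in the exponent.\<close>
    have "exp (a * real b) \<le> 1 + a * real b + (a * real b)\<^sup>2"
      using True a0 by (intro exp_bound) auto
    then have "(exp (a * real b) - 1) / real b + 1 \<le> 1 + (a + a\<^sup>2 * real b)"
      using b by (simp add: field_simps power2_eq_square)
    also have "\<dots> \<le> exp (a + a\<^sup>2 * real b)" by (rule exp_ge_add_one_self)
    finally have "exp (- a) * ((exp (a * real b) - 1) / real b + 1) \<le> exp (a\<^sup>2 * real b)"
      by (simp add: exp_add exp_minus field_simps)
    then have "(exp (- a) * ((exp (a * real b) - 1) / real b + 1)) ^ D \<le> exp (a\<^sup>2 * real b) ^ D"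
      using a0 b by (intro power_mono) auto
    also have "\<dots> = exp (a\<^sup>2 * real (D * b))" by (simp add: exp_of_nat_mult[symmetric] algebra_simps)
    also have "\<dots> \<le> exp (a\<^sup>2 * real k)"
      using \<open>D * b \<le> k\<close> by (simp only: exp_le_cancel_iff) (intro mult_left_mono of_nat_mono, auto)
    \<comment> \<open>\<open>exp_le\<close> states \<open>exp 1 \<le> 3\<close>, so 81/10 may be
      weakened to \<open>exp 1\<close> and exponents compared.\<close>
    finally have "exp 1 \<le> exp (a\<^sup>2 * real k)" using main exp_le by linarith
    then have "real k \<le> (real n * real b)\<^sup>2"
      using k by (simp add: a_def power2_eq_square field_simps)
    then show ?thesis by (simp add: real_le_lsqrt)
  next
    case False
    \<comment> \<open>Now \<open>n b^2 > k\<close>. If \<open>b < sqrt k\<close>, division by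
      \<open>b\<close> gives \<open>n b > sqrt k\<close>; otherwise \<open>n \<ge> 1\<close> is
      enough.\<close>
    then have nbb: "real k < real n * real b * real b" using k by (simp add: a_def field_simps)
    then have n: "n \<ge> 1" by (cases n) auto
    show ?thesis
    proof (cases "sqrt (real k) \<le> real b")
      case True
      also have "real b \<le> real n * real b" using n by (simp add: mult_le_cancel_right1)
      finally show ?thesis .
    next
      case False
      have "sqrt (real k) * sqrt (real k) < real n * real b * real b" using nbb by simp
      also have "\<dots> \<le> real n * real b * sqrt (real k)" using False by (intro mult_left_mono) auto
      finally show ?thesis by (intro less_imp_le) (erule mult_right_less_imp_less, simp)
    qed
  qed
qed

section \<open>Paired blocks, in which one ball takes the colour of its partner\<close>

text \<open>The fixed-point-free involution exchanging \<open>2 * m\<close> and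
  \<open>2 * m + 1\<close>; initial segments of even length are closed under it.\<close>

definition partner :: "nat \<Rightarrow> nat" where
  "partner j = (if even j then j + 1 else j - 1)"

lemma partner_neq [simp]: "partner j \<noteq> j" "j \<noteq> partner j"
  by (auto simp: partner_def elim: oddE)

lemma partner_partner [simp]: "partner (partner j) = j"
  by (auto simp: partner_def elim: oddE)

lemma partner_less: "even b \<Longrightarrow> j < b \<Longrightarrow> partner j < b"
  by (auto simp: partner_def elim!: evenE oddE)

text \<open>The vector of colour multiplicities after recolouring \<open>j\<close> is all ones plus
  the unit vector at \<open>partner j\<close> minus that at \<open>j\<close>. The overlap is an
  inner product of two such vectors; the corrections are orthogonal to the all-ones vector and meet
  each other in 2, -2 or 0.\<close>

lemma card_partner_matches:
  assumes b: "even b" and j: "j < b" and j': "j' < b"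
  shows "real (card {(i, i'). i < b \<and> i' < b \<and> (if i = j then partner j else i) = (if i' = j' then partner j' else i')})
    = real b + 2 * of_bool (j' = j) - 2 * of_bool (j' = partner j)"
proof -
  \<comment> \<open>\<open>h c\<close> is the multiplicity of colour \<open>c\<close> after
    recolouring \<open>j'\<close>.\<close>
  define h where "h c = real (card {i'. i' < b \<and> c = (if i' = j' then partner j' else i')})" for c
  have h: "h c = 1 + of_bool (c = partner j') - of_bool (c = j')" if "c < b" for c
  proof -
    have "{i'. i' < b \<and> c = (if i' = j' then partner j' else i')}
        = (if c = j' then {} else if c = partner j' then {j', c} else {c})"
      using that j' by auto
    then show ?thesis by (auto simp: h_def)
  qed
  have "{(i, i'). i < b \<and> i' < b \<and> (if i = j then partner j else i) = (if i' = j' then partner j' else i')}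
      = (SIGMA i:{..<b}. {i'. i' < b \<and> (if i = j then partner j else i) = (if i' = j' then partner j' else i')})"
    by auto
  then have "real (card {(i, i'). i < b \<and> i' < b \<and> (if i = j then partner j else i) = (if i' = j' then partner j' else i')})
      = (\<Sum>i<b. h (if i = j then partner j else i))"
    by (simp add: h_def)
  also have "\<dots> = h (partner j) + (\<Sum>i\<in>{..<b} - {j}. h i)"
    using j by (subst sum.remove[of _ j]) auto
  also have "\<dots> = h (partner j) - h j + (\<Sum>i<b. h i)"
    using j by (simp add: sum_diff1)
  also have "(\<Sum>i<b. h i) = real b"
    using j' partner_less[OF b j'] by (simp add: h sum.distrib sum_subtractf of_bool_def)
  also have "h (partner j) - h j = 2 * of_bool (j' = j) - 2 * of_bool (j' = partner j)"
  proof -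
    have "partner j = partner j' \<longleftrightarrow> j' = j" "j = partner j' \<longleftrightarrow> j' = partner j"
      by (metis partner_partner)+
    then show ?thesis
      using h[OF j] h[OF partner_less[OF b j]] by auto
  qed
  finally show ?thesis by simp
qed

text \<open>The excesses 2 and -2 are equally likely, so linear terms cancel and the mean factor per
  block is \<open>1 + (cosh (2 * r) - 1) / M\<close> with \<open>r = n / k\<close>. Each block loses
  one colour, so \<open>D\<close> blocks produce the gap \<open>2 * Delta - 1\<close>.\<close>

lemma paired_blocks_bound:
  assumes k: "k > 0" "D * (2 * M) \<le> k" and M: "M > 0" and D: "2 * Delta - 1 \<le> int D"
    and est: "\<And>v. err_prob k n est v Delta \<le> 1 / 10"
  shows "real M \<le> real D * (cosh (2 * real n / real k) - 1)"
proof -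
  define r where "r = real n / real k"
  let ?b = "2 * M"
  have row: "(\<Sum>j'<?b. exp (r * (real (card {(i, i'). i < ?b \<and> i' < ?b \<and>
      (if i = j then partner j else i) = (if i' = j' then partner j' else i')}) - real ?b)))
      = real ?b + 2 * (cosh (2 * r) - 1)" if j: "j < ?b" for j
  proof -
    have "exp (r * (real (card {(i, i'). i < ?b \<and> i' < ?b \<and>
        (if i = j then partner j else i) = (if i' = j' then partner j' else i')}) - real ?b))
        = 1 + of_bool (j' = j) * (exp (2 * r) - 1) + of_bool (j' = partner j) * (exp (- (2 * r)) - 1)"
      if "j' < ?b" for j'
      by (subst card_partner_matches) (use j that in \<open>auto simp: algebra_simps\<close>)
    then show ?thesis
      using j partner_less[of ?b j]
      by (simp add: sum.distrib of_bool_def if_distrib[of "\<lambda>x. x * _"] cosh_def cong: if_cong)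
  qed
  have "81 / 10 \<le> ((\<Sum>j<?b. \<Sum>j'<?b. exp (r * (real (card {(i, i'). i < ?b \<and> i' < ?b \<and>
      (if i = j then partner j else i) = (if i' = j' then partner j' else i')}) - real ?b))) / (real ?b)\<^sup>2) ^ D"
    unfolding r_def
  proof (rule block_second_moment_bound[OF k, where q = "?b - 1"])
    show "(if i = j then partner j else i) < ?b" if "j < ?b" "i < ?b" for i j
      using that partner_less[of ?b j] by auto
    show "card ((\<lambda>i. if i = j then partner j else i) ` {..<?b}) \<le> ?b - 1" if "j < ?b" for j
    proof -
      \<comment> \<open>Colour \<open>j\<close> disappears and no new colour enters.\<close>
      have "(\<lambda>i. if i = j then partner j else i) ` {..<?b} \<subseteq> {..<?b} - {j}"
        using that partner_less[of ?b j] by auto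
      then have "card ((\<lambda>i. if i = j then partner j else i) ` {..<?b}) \<le> card ({..<?b} - {j})"
        by (intro card_mono) auto
      then show ?thesis using that by simp
    qed
    have "int (D * (?b - 1)) = int (D * ?b) - int D" using M by (simp add: of_nat_diff algebra_simps)
    then show "int k - int (D * ?b) + int (D * (?b - 1)) \<le> int k - 2 * Delta + 1"
      using D by linarith
  qed (use M est in auto)
  also have "(\<Sum>j<?b. \<Sum>j'<?b. exp (r * (real (card {(i, i'). i < ?b \<and> i' < ?b \<and>
      (if i = j then partner j else i) = (if i' = j' then partner j' else i')}) - real ?b))) / (real ?b)\<^sup>2
      = 1 + (cosh (2 * r) - 1) / real M" (is "?S / _ = _")
  proof -
    have "?S = (\<Sum>j<?b. real ?b + 2 * (cosh (2 * r) - 1))"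
      by (rule sum.cong[OF refl]) (rule row, simp)
    then show ?thesis using M by (simp add: power2_eq_square field_simps)
  qed
  also have "\<dots> ^ D \<le> exp ((cosh (2 * r) - 1) / real M) ^ D"
    by (intro power_mono exp_ge_add_one_self) (simp add: cosh_real_ge_1)
  also have "\<dots> = exp (real D * ((cosh (2 * r) - 1) / real M))" by (simp only: exp_of_nat_mult)
  finally have "exp 1 \<le> exp (real D * ((cosh (2 * r) - 1) / real M))" using exp_le by linarith
  then show ?thesis using M by (simp add: r_def field_simps)
qed

section \<open>Existence of accurate estimators\<close>

text \<open>Without this, the \<open>LEAST\<close> in the definition of the sample complexity would be unspecified.\<close>

lemma accurate_estimator_exists:
  assumes k: "k > 0" and Delta: "Delta \<ge> 1"
  shows "\<exists>n (est :: nat list \<Rightarrow> int). \<forall>u. err_prob k n est u Delta \<le> 1 / 10"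
proof -
  \<comment> \<open>Each single ball is missed with probability below \<open>1 / (10 * k)\<close>.
    By a union bound all balls are drawn with probability at least 9/10, and then the number of
    observed colours is exact.\<close>
  obtain n where n: "((real k - 1) / real k) ^ n < 1 / (10 * real k)"
    using real_arch_pow_inv[of "1 / (10 * real k)" "(real k - 1) / real k"] k by auto
  have "err_prob k n (\<lambda>ys. int (card (set ys))) u Delta \<le> 1 / 10" for u
  proof -
    let ?B = "{xs \<in> index_samples k n. \<bar>int (card (set (map u xs))) - int (num_colors k u)\<bar> \<ge> Delta}"
    let ?A = "\<lambda>i. {xs. set xs \<subseteq> {0..<k} - {i} \<and> length xs = n}"
    have "?B \<subseteq> (\<Union>i\<in>{0..<k}. ?A i)"
    proof
      fix xs assume xs: "xs \<in> ?B"
      then have "set xs \<noteq> {0..<k}" using Delta by (auto simp: num_colors_def)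
      with xs show "xs \<in> (\<Union>i\<in>{0..<k}. ?A i)" by (auto simp: index_samples_def)
    qed
    then have "card ?B \<le> card (\<Union>i\<in>{0..<k}. ?A i)"
      by (intro card_mono) (auto intro!: finite_lists_length_eq)
    also have "\<dots> \<le> (\<Sum>i\<in>{0..<k}. card (?A i))" by (rule card_UN_le) simp
    also have "\<dots> = k * (k - 1) ^ n" by (simp add: card_lists_length_eq)
    finally have "real (card ?B) \<le> real (k * (k - 1) ^ n)" by (rule of_nat_mono)
    also have "\<dots> = real k * (real k - 1) ^ n" using k by (simp add: of_nat_diff)
    also have "\<dots> = real k * real k ^ n * ((real k - 1) / real k) ^ n"
      using k by (simp add: power_divide)
    also have "\<dots> \<le> real k * real k ^ n * (1 / (10 * real k))"
      using n by (intro mult_left_mono) auto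
    finally show ?thesis using k by (simp add: err_prob_eq field_simps)
  qed
  then show ?thesis by blast
qed

lemma sample_complexity_estimator:
  assumes "k > 0" "Delta \<ge> 1"
  obtains est where "\<And>u. err_prob k (sample_complexity k Delta) est u Delta \<le> 1 / 10"
  using LeastI_ex[OF accurate_estimator_exists[OF assms]] unfolding sample_complexity_def by blast

section \<open>Choice of the block sizes for the two lower bounds\<close>

text \<open>The budget of \<open>C = k - 2 * Delta + 1\<close> colours is split in halves, for the
  merged blocks and for the \<open>k mod b\<close> balls left over. With \<open>b\<close> near
  \<open>2 * k / C\<close> both fit once \<open>C \<ge> 4 * sqrt k\<close>; for smaller
  \<open>C\<close> the claim follows from \<open>n \<ge> 1\<close>.\<close>

lemma sample_complexity_lower_bound_birthday:
  assumes k: "k \<ge> 2" and Delta: "1 \<le> Delta" "real_of_int Delta \<le> real k / 2"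
  shows "(real k - 2 * real_of_int Delta) / (4 * sqrt (real k)) \<le> real (sample_complexity k Delta)"
proof -
  define n where "n = sample_complexity k Delta"
  define C where "C = real k - 2 * real_of_int Delta + 1"
  define s where "s = sqrt (real k)"
  have s: "s > 0" "s * s = real k" using k by (auto simp: s_def)
  have C: "1 \<le> C" "C \<le> real k" using Delta by (auto simp: C_def)
  obtain est where est: "\<And>u. err_prob k n est u Delta \<le> 1 / 10"
    unfolding n_def by (rule sample_complexity_estimator[of k Delta]) (use k Delta(1) in auto)
  have bound: "s \<le> real n * real b" if "b > 0" "real (k div b) + real (k mod b) \<le> C" for b
  proof -
    have "real_of_int (int (k div b) + int (k mod b)) \<le> real_of_int (int k - 2 * Delta + 1)"
      using that by (simp add: C_def)
    then have "int (k div b) + int (k mod b) \<le> int k - 2 * Delta + 1"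
      by (simp only: of_int_le_iff)
    then show ?thesis
      unfolding s_def using merged_blocks_bound[of k b Delta n est] k that est by simp
  qed
  \<comment> \<open>A single block of all \<open>k\<close> balls has one colour, which is within the
    budget, and its bound excludes \<open>n = 0\<close>.\<close>
  have "n \<noteq> 0" by (rule notI) (use bound[of k] k C s in simp)
  then have n: "real n \<ge> 1" by simp
  show ?thesis
  proof (cases "C < 4 * s")
    case True
    then have "(real k - 2 * real_of_int Delta) / (4 * s) \<le> 1" using s by (simp add: C_def)
    then show ?thesis using n by (simp add: n_def s_def)
  next
    case False
    define b where "b = nat \<lceil>2 * real k / C\<rceil>"
    have b: "2 * real k / C \<le> real b" "real b < 2 * real k / C + 1"
      using C k by (auto simp: b_def) linarith+
    have "2 * real k / C > 0" using C k by simp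
    then have b0: "b > 0" using b by linarith
    have "real (k div b) \<le> real k / real b" by (rule of_nat_div_le_of_nat)
    also have "\<dots> \<le> C / 2" using b b0 C by (simp add: field_simps)
    finally have 1: "real (k div b) \<le> C / 2" .
    have "k mod b < b" using b0 by simp
    then have "real (k mod b) \<le> real b - 1" by linarith
    also have "\<dots> \<le> 2 * real k / C" using b by simp
    \<comment> \<open>The left-over balls fit if \<open>C^2 \<ge> 4 * k\<close>; the case assumption
      gives \<open>C^2 \<ge> 16 * k\<close>.\<close>
    also have "\<dots> \<le> C / 2"
    proof -
      have "4 * s * (4 * s) \<le> C * C" using False s by (intro mult_mono) auto
      then show ?thesis using C s by (simp add: field_simps)
    qed
    finally have "real (k div b) + real (k mod b) \<le> C" using 1 by simp
    then have "s \<le> real n * real b" using bound b0 by simp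
    \<comment> \<open>\<open>C \<le> k\<close> absorbs the rounding:
      \<open>b < 2 * k / C + 1 \<le> 3 * k / C\<close>.\<close>
    also have "\<dots> \<le> real n * (3 * real k / C)"
      using b C by (intro mult_left_mono) (auto simp: field_simps)
    finally have "s * C \<le> 3 * real n * real k" using C by (simp add: field_simps)
    also have "\<dots> = s * (3 * s * real n)" by (simp flip: s(2))
    finally have "C \<le> 3 * s * real n" using s(1) by simp
    then have "C \<le> 4 * s * real n" using s n by (simp add: order_trans)
    then have "(real k - 2 * real_of_int Delta) / (4 * s) \<le> real n"
      using s by (simp add: C_def field_simps)
    then show ?thesis by (simp add: n_def s_def)
  qed
qed

text \<open>By the duplication formula the two sides differ by a positive multiple of
  \<open>(cosh (y / 2) - 1)^2\<close>. A factor 4 in \<open>cosh - 1\<close> can thus be paid for by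
  halving the argument.\<close>

lemma cosh_half_le:
  fixes y :: real
  shows "cosh (y / 2) - 1 \<le> (cosh y - 1) / 4"
proof -
  have "cosh y = 2 * (cosh (y / 2))\<^sup>2 - 1" using cosh_double_cosh[of "y / 2"] by simp
  moreover have "0 \<le> (cosh (y / 2) - 1) * (cosh (y / 2) - 1)" by simp
  ultimately show ?thesis by (simp add: power2_eq_square algebra_simps)
qed

text \<open>\<open>M + 1 \<le> 2 * M\<close> and \<open>D \<le> 2 * Delta\<close> turn
  \<open>M \<le> D * h\<close> into \<open>k \<le> 16 * Delta^2 * h\<close>, that is
  \<open>z / 4 \<le> h\<close>. Halving the arcosh removes the 4.\<close>

lemma sample_complexity_lower_bound_arcosh:
  assumes k: "k \<ge> 2" and Delta: "1 \<le> Delta" "real_of_int Delta < real k / 4"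
  shows "real k * arcosh (1 + real k / (4 * (real_of_int Delta)\<^sup>2)) / 4 \<le> real (sample_complexity k Delta)"
proof -
  define n where "n = sample_complexity k Delta"
  define D where "D = nat (2 * Delta - 1)"
  define M where "M = k div (2 * D)"
  define z where "z = real k / (4 * (real_of_int Delta)\<^sup>2)"
  define h where "h = cosh (2 * real n / real k) - 1"
  have z: "z \<ge> 0" by (simp add: z_def)
  obtain est where est: "\<And>u. err_prob k n est u Delta \<le> 1 / 10"
    unfolding n_def by (rule sample_complexity_estimator[of k Delta]) (use k Delta(1) in auto)
  have D: "int D = 2 * Delta - 1" "D > 0" using Delta by (auto simp: D_def)
  \<comment> \<open>Since \<open>Delta < k / 4\<close>, each of the \<open>D\<close> blocks has room
    for at least one pair.\<close>
  have "2 * D \<le> k" using D Delta by linarith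
  then have M: "M \<ge> 1" using D by (simp add: M_def div_greater_zero_iff Suc_le_eq)
  have h: "h \<ge> 0" by (simp add: h_def cosh_real_ge_1)
  have "D * (2 * M) \<le> k" using div_times_less_eq_dividend[of k "2 * D"] by (simp add: M_def algebra_simps)
  then have M_le: "real M \<le> real D * h"
    unfolding h_def using paired_blocks_bound[of k D M Delta n est] k M D est by simp
  have "k < (M + 1) * (2 * D)" unfolding M_def using D dividend_less_div_times[of "2 * D" k] by (simp add: algebra_simps)
  also have "\<dots> \<le> (2 * M) * (2 * D)" using M by (intro mult_right_mono) auto
  finally have "real k \<le> real (4 * D * M)" by (subst of_nat_le_iff) (simp add: ac_simps)
  also have "\<dots> = 4 * real D * real M" by simp
  also have "\<dots> \<le> 4 * real D * (real D * h)"
    using M_le by (intro mult_left_mono) auto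
  also have "\<dots> = 4 * (real D)\<^sup>2 * h" by (simp add: power2_eq_square)
  also have "\<dots> \<le> 4 * (2 * real_of_int Delta)\<^sup>2 * h"
    using D Delta h by (intro mult_right_mono mult_left_mono power_mono) linarith+
  finally have "z / 4 \<le> h" using Delta by (simp add: z_def power2_eq_square field_simps)
  moreover have "cosh (arcosh (1 + z) / 2) - 1 \<le> z / 4"
    using cosh_half_le[of "arcosh (1 + z)"] z by simp
  ultimately have "cosh (arcosh (1 + z) / 2) \<le> cosh (2 * real n / real k)" by (simp add: h_def)
  then have "arcosh (1 + z) / 2 \<le> 2 * real n / real k"
    using z by (subst (asm) cosh_real_nonneg_le_iff) auto
  then show ?thesis using k by (simp add: z_def n_def field_simps)
qed

section \<open>The order of magnitude of the arcosh\<close>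

text \<open>For the regime \<open>Delta \<le> sqrt k\<close>, with \<open>x = k / Delta^2\<close>.
  The arcosh is the logarithm of \<open>1 + x / 4 + w\<close>, which lies between
  \<open>sqrt (1 + x)\<close> and \<open>(1 + x)^2\<close>.\<close>

lemma arcosh_log_bounds:
  fixes x :: real
  assumes x: "x \<ge> 1"
  shows "ln (1 + x) / 2 \<le> arcosh (1 + x / 4)" "arcosh (1 + x / 4) \<le> 2 * ln (1 + x)"
proof -
  define w where "w = sqrt ((1 + x / 4)\<^sup>2 - 1)"
  have arcosh: "arcosh (1 + x / 4) = ln (1 + x / 4 + w)"
    unfolding w_def using x by (intro arcosh_real_def) simp
  have "x / 4 \<le> w" unfolding w_def using x
    by (intro real_le_rsqrt) (simp add: power2_eq_square algebra_simps)
  have "1 + x \<le> (1 + x / 2)\<^sup>2" by (simp add: power2_eq_square algebra_simps)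
  also have "\<dots> \<le> (1 + x / 4 + w)\<^sup>2" using \<open>x / 4 \<le> w\<close> x by (intro power_mono) auto
  finally have "1 + x \<le> (1 + x / 4 + w)\<^sup>2" .
  then have "ln (1 + x) \<le> ln ((1 + x / 4 + w)\<^sup>2)" using x by (intro ln_mono) auto
  also have "\<dots> = 2 * ln (1 + x / 4 + w)" using \<open>x / 4 \<le> w\<close> x by (simp add: ln_realpow)
  finally show "ln (1 + x) / 2 \<le> arcosh (1 + x / 4)" by (simp add: arcosh)
  have "w \<le> 1 + x / 4" unfolding w_def using x by (intro real_le_lsqrt) auto
  moreover have "(1 + x)\<^sup>2 = 1 + 2 * x + x * x" "x * x \<ge> 0" by (simp_all add: power2_eq_square algebra_simps)
  ultimately have "1 + x / 4 + w \<le> (1 + x)\<^sup>2"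
    using x by linarith
  then have "ln (1 + x / 4 + w) \<le> ln ((1 + x)\<^sup>2)" using x \<open>x / 4 \<le> w\<close> by (intro ln_mono) auto
  also have "\<dots> = 2 * ln (1 + x)" using x by (simp add: ln_realpow)
  finally show "arcosh (1 + x / 4) \<le> 2 * ln (1 + x)" by (simp add: arcosh)
qed

text \<open>For the regime \<open>Delta \<ge> sqrt k\<close>. The arcosh is
  \<open>ln (1 + w)\<close> with \<open>sqrt x / 2 \<le> w \<le> sqrt x\<close>, and for such small
  \<open>w\<close> the logarithm is of order \<open>w\<close>.\<close>

lemma arcosh_sqrt_bounds:
  fixes x :: real
  assumes x: "0 \<le> x" "x \<le> 1"
  shows "sqrt x / 4 \<le> arcosh (1 + x / 4)" "arcosh (1 + x / 4) \<le> sqrt x"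
proof -
  define s where "s = sqrt x"
  define w where "w = x / 4 + sqrt ((1 + x / 4)\<^sup>2 - 1)"
  have s: "0 \<le> s" "s \<le> 1" "x = s * s" using x by (auto simp: s_def)
  have ss: "s * s \<le> s" using s by (simp add: mult_left_le)
  have arcosh: "arcosh (1 + x / 4) = ln (1 + w)"
    unfolding w_def using x by (subst arcosh_real_def) (auto simp: add.assoc)
  have "s / 2 \<le> sqrt ((1 + x / 4)\<^sup>2 - 1)"
    by (intro real_le_rsqrt) (simp add: s power2_eq_square algebra_simps)
  then have lower: "s / 2 \<le> w" using x by (simp add: w_def)
  \<comment> \<open>This gives
    \<open>(1 + x / 4)^2 - 1 = x / 2 + x^2 / 16 \<le> 9 / 16 * x\<close>.\<close>
  have "s * s * (s * s) \<le> s * s" using s ss by (intro mult_left_le) auto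
  then have "sqrt ((1 + x / 4)\<^sup>2 - 1) \<le> 3 / 4 * s"
    using s by (intro real_le_lsqrt) (auto simp: power2_eq_square algebra_simps)
  then have upper: "w \<le> s" using ss by (simp add: w_def s)
  have "s / 4 \<le> (s / 2) / (1 + s / 2)" using s ss by (simp add: field_simps)
  also have "\<dots> \<le> ln (1 + s / 2)" using ln_add1_ge[of "s / 2"] s by (simp only: add.commute)
  also have "\<dots> \<le> ln (1 + w)" using lower s by simp
  finally show "sqrt x / 4 \<le> arcosh (1 + x / 4)" by (simp add: arcosh s_def)
  have "ln (1 + w) \<le> w" using lower s by (intro ln_add_one_self_le_self) auto
  then show "arcosh (1 + x / 4) \<le> sqrt x" using upper by (simp add: arcosh s_def)
qed

theorem theorem3:
  shows "\<exists>c::real. c > 0 \<and>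
    (\<forall>(k::nat) (Delta::int). k \<ge> 2 \<longrightarrow>
       ((1 \<le> Delta \<and> real_of_int Delta \<le> real k / 2 \<longrightarrow>
           real (sample_complexity k Delta) \<ge> c * (real k - 2 * real_of_int Delta) / sqrt (real k)) \<and>
        (1 \<le> Delta \<and> real_of_int Delta < real k / 4 \<longrightarrow>
           real (sample_complexity k Delta)
             \<ge> c * real k * arcosh (1 + real k / (4 * (real_of_int Delta)\<^sup>2))))) \<and>
    (\<forall>(k::nat) (Delta::int). k \<ge> 2 \<and> 1 \<le> Delta \<and> real_of_int Delta \<le> sqrt (real k) \<longrightarrow>
       c * (real k * ln (1 + real k / (real_of_int Delta)\<^sup>2))
         \<le> real k * arcosh (1 + real k / (4 * (real_of_int Delta)\<^sup>2)) \<and>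
       real k * arcosh (1 + real k / (4 * (real_of_int Delta)\<^sup>2))
         \<le> (real k * ln (1 + real k / (real_of_int Delta)\<^sup>2)) / c) \<and>
    (\<forall>(k::nat) (Delta::int). k \<ge> 2 \<and> 1 \<le> Delta \<and> real_of_int Delta \<ge> sqrt (real k) \<longrightarrow>
       c * (real k powr (3/2) / real_of_int Delta)
         \<le> real k * arcosh (1 + real k / (4 * (real_of_int Delta)\<^sup>2)) \<and>
       real k * arcosh (1 + real k / (4 * (real_of_int Delta)\<^sup>2))
         \<le> (real k powr (3/2) / real_of_int Delta) / c)"
proof (intro exI[of _ "1 / 4"] conjI allI impI; (elim conjE)?)
  \<comment> \<open>The witness 1/4 is the constant of both lower bounds; it also covers the
    comparison factors 1/2 and 2 for the logarithm, and 1/4 and 1 for the square root.\<close>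
  fix k :: nat and Delta :: int
  assume k: "2 \<le> k" and Delta: "1 \<le> Delta"
  define x where "x = real k / (real_of_int Delta)\<^sup>2"
  have x4: "real k / (4 * (real_of_int Delta)\<^sup>2) = x / 4" by (simp add: x_def)
  have k0: "real k \<ge> 0" by simp
  {
    assume "real_of_int Delta \<le> real k / 2"
    from sample_complexity_lower_bound_birthday[OF k Delta this]
    show "1 / 4 * (real k - 2 * real_of_int Delta) / sqrt (real k) \<le> real (sample_complexity k Delta)"
      by simp
  next
    assume "real_of_int Delta < real k / 4"
    from sample_complexity_lower_bound_arcosh[OF k Delta this]
    show "1 / 4 * real k * arcosh (1 + real k / (4 * (real_of_int Delta)\<^sup>2)) \<le> real (sample_complexity k Delta)"
      by simp
  next
    assume "real_of_int Delta \<le> sqrt (real k)"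
    then have "(real_of_int Delta)\<^sup>2 \<le> (sqrt (real k))\<^sup>2" using Delta by (intro power_mono) auto
    then have x: "x \<ge> 1" using Delta by (simp add: x_def)
    then have "ln (1 + x) \<ge> 0" by simp
    with arcosh_log_bounds[OF x]
    have "1 / 4 * ln (1 + x) \<le> arcosh (1 + x / 4)" "arcosh (1 + x / 4) \<le> 4 * ln (1 + x)" by linarith+
    from mult_left_mono[OF this(1) k0] mult_left_mono[OF this(2) k0]
    show "1 / 4 * (real k * ln (1 + real k / (real_of_int Delta)\<^sup>2))
        \<le> real k * arcosh (1 + real k / (4 * (real_of_int Delta)\<^sup>2))"
      and "real k * arcosh (1 + real k / (4 * (real_of_int Delta)\<^sup>2))
        \<le> real k * ln (1 + real k / (real_of_int Delta)\<^sup>2) / (1 / 4)"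
      unfolding x4 by (simp_all flip: x_def)
  next
    assume "sqrt (real k) \<le> real_of_int Delta"
    then have "(sqrt (real k))\<^sup>2 \<le> (real_of_int Delta)\<^sup>2" by (intro power_mono) auto
    then have x: "0 \<le> x" "x \<le> 1" using Delta by (simp_all add: x_def)
    \<comment> \<open>Rewriting \<open>k powr (3 / 2) / Delta\<close> as \<open>k * sqrt x\<close>
      reduces the claim to comparing the arcosh with \<open>sqrt x\<close>.\<close>
    have "real k powr (3 / 2) = real k powr (1 + 1 / 2)" by simp
    also have "\<dots> = real k * sqrt (real k)" using k by (subst powr_add) (simp add: powr_half_sqrt)
    finally have "real k powr (3 / 2) / real_of_int Delta = real k * sqrt x"
      using Delta by (simp add: x_def real_sqrt_divide)
    moreover have "sqrt x \<ge> 0" using x by simp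
    with arcosh_sqrt_bounds[OF x]
    have "1 / 4 * sqrt x \<le> arcosh (1 + x / 4)" "arcosh (1 + x / 4) \<le> 4 * sqrt x" by linarith+
    note mult_left_mono[OF this(1) k0] mult_left_mono[OF this(2) k0]
    ultimately show "1 / 4 * (real k powr (3 / 2) / real_of_int Delta)
        \<le> real k * arcosh (1 + real k / (4 * (real_of_int Delta)\<^sup>2))"
      and "real k * arcosh (1 + real k / (4 * (real_of_int Delta)\<^sup>2))
        \<le> real k powr (3 / 2) / real_of_int Delta / (1 / 4)"
      unfolding x4 by simp_all
  }
qed simp

end
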